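(* For every positive integer $k$, every selectively $k$-star-ccc topological space is $k$-SL. In particular (case $k=1$), every selectively star-ccc space is SL.
   Context: For an open cover $\mathcal{U}$ of a space $X$ and $A\subset X$, put $\operatorname{st}^1(A,\mathcal{U})=\bigcup\{U\in\mathcal{U}:U\cap A\neq\emptyset\}$ and inductively $\operatorname{st}^{n+1}(A,\mathcal{U})=\bigcup\{U\in\mathcal{U}:U\cap \operatorname{st}^n(A,\mathcal{U})\neq\emptyset\}$. For a positive integer $k$, $X$ is $k$-SL ($k$-star-Lindelöf) if for every open cover $\mathcal{U}$ of $X$ there is a countable $\mathcal{U}'\subset\mathcal{U}$ with $\operatorname{st}^k(\bigcup\mathcal{U}',\mathcal{U})=X$; SL means $1$-SL. For a positive integer $k$, $X$ is selectively $k$-star-ccc if for every open cover $\mathcal{U}$ of $X$ and every sequence $(\mathcal{A}_n:n\in\omega)$ of maximal pairwise disjoint families of open subsets of $X$, there is a sequence $(A_n:n\in\omega)$ with $A_n\in\mathcal{A}_n$ for all $n$ such that $\operatorname{st}^k(\bigcup_{n\in\omega}A_n,\mathcal{U})=X$. Selectively star-ccc means selectively $1$-star-ccc. *)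

theory Defs
  imports "HOL-Analysis.Abstract_Topology"
begin

definition open_cover :: "'a topology \<Rightarrow> 'a set set \<Rightarrow> bool" where
  "open_cover X \<U> \<longleftrightarrow> (\<forall>U\<in>\<U>. openin X U) \<and> \<Union>\<U> = topspace X"

text \<open>The iterated star \<open>st\<^sup>k(A, \<U>)\<close>. The value at \<open>0\<close> is only a base for the recursion;
  it makes \<open>st (Suc 0) A \<U>\<close> the union of the members of \<open>\<U>\<close> that meet \<open>A\<close>.\<close>

primrec st :: "nat \<Rightarrow> 'a set \<Rightarrow> 'a set set \<Rightarrow> 'a set" where
  "st 0 A \<U> = A"
| "st (Suc n) A \<U> = \<Union>{U \<in> \<U>. U \<inter> st n A \<U> \<noteq> {}}"

definition k_star_Lindelof :: "nat \<Rightarrow> 'a topology \<Rightarrow> bool" where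
  "k_star_Lindelof k X \<longleftrightarrow>
    (\<forall>\<U>. open_cover X \<U> \<longrightarrow>
      (\<exists>\<V>. \<V> \<subseteq> \<U> \<and> countable \<V> \<and> st k (\<Union>\<V>) \<U> = topspace X))"

definition star_Lindelof :: "'a topology \<Rightarrow> bool" where
  "star_Lindelof X \<longleftrightarrow> k_star_Lindelof 1 X"

definition disjoint_open_family :: "'a topology \<Rightarrow> 'a set set \<Rightarrow> bool" where
  "disjoint_open_family X \<A> \<longleftrightarrow> (\<forall>A\<in>\<A>. openin X A) \<and> pairwise disjnt \<A>"

text \<open>Maximality is with respect to inclusion. The empty set is allowed as a member, so a maximal
  family always contains it. Discarding it would change the notion of a selectively
  \<open>k\<close>-star-ccc space only for the empty space, since stars are monotone in their first argument.\<close>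

definition maximal_disjoint_open_family :: "'a topology \<Rightarrow> 'a set set \<Rightarrow> bool" where
  "maximal_disjoint_open_family X \<A> \<longleftrightarrow>
    disjoint_open_family X \<A> \<and>
    (\<forall>\<B>. disjoint_open_family X \<B> \<and> \<A> \<subseteq> \<B> \<longrightarrow> \<B> = \<A>)"

definition selectively_k_star_ccc :: "nat \<Rightarrow> 'a topology \<Rightarrow> bool" where
  "selectively_k_star_ccc k X \<longleftrightarrow>
    (\<forall>\<U> (\<A> :: nat \<Rightarrow> 'a set set).
      open_cover X \<U> \<and> (\<forall>n. maximal_disjoint_open_family X (\<A> n)) \<longrightarrow>
      (\<exists>A. (\<forall>n. A n \<in> \<A> n) \<and> st k (\<Union>n. A n) \<U> = topspace X))"

definition selectively_star_ccc :: "'a topology \<Rightarrow> bool" where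
  "selectively_star_ccc X \<longleftrightarrow> selectively_k_star_ccc 1 X"

end

theory Submission
  imports Defs
begin

text \<open>A maximal disjoint family of open sets refining the cover is, by local refinement of any
  candidate for an extension, maximal among all disjoint families of open sets. Apply the selection
  principle to the constant sequence with this value; enlarging each selected set to a member of the
  cover yields the required countable subfamily.\<close>

text \<open>Lets the selected sets grow to members of the cover without losing any point of the
  star.\<close>

lemma st_mono:
  assumes "A \<subseteq> B"
  shows "st k A \<U> \<subseteq> st k B \<U>"
  using assms by (induction k) auto

lemma st_subset_topspace:
  assumes "open_cover X \<U>" and "A \<subseteq> topspace X"
  shows "st k A \<U> \<subseteq> topspace X"
  using assms by (cases k) (auto simp: open_cover_def)

text \<open>Zorn's lemma gives maximality among refining families only; the rest of the proof
  upgrades it to maximality among all disjoint open families. Such a maximal family contains the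
  empty set, which must lie in a member of the cover, hence \<open>ne\<close>.\<close>

lemma maximal_disjoint_open_refinement_exists:
  assumes cover: "open_cover X \<U>" and ne: "\<U> \<noteq> {}"
  obtains \<A> where "maximal_disjoint_open_family X \<A>" and "\<And>A. A \<in> \<A> \<Longrightarrow> \<exists>U\<in>\<U>. A \<subseteq> U"
proof -
  define F where "F = {\<A>. disjoint_open_family X \<A> \<and> (\<forall>A\<in>\<A>. \<exists>U\<in>\<U>. A \<subseteq> U)}"
  have "\<Union>C \<in> F" if "subset.chain F C" for C
  proof -
    have CF: "C \<subseteq> F" and chain: "\<And>S T. S \<in> C \<Longrightarrow> T \<in> C \<Longrightarrow> S \<subseteq> T \<or> T \<subseteq> S"
      using that by (auto simp: subset_chain_def)
    have "disjnt A B" if AB: "A \<in> \<Union>C" "B \<in> \<Union>C" "A \<noteq> B" for A B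
    proof -
      \<comment> \<open>Of two families in the chain that contain \<open>A\<close> and
        \<open>B\<close>, the larger contains both.\<close>
      obtain S where "S \<in> C" "A \<in> S" "B \<in> S"
        using AB chain by blast
      moreover from \<open>S \<in> C\<close> CF have "pairwise disjnt S"
        by (auto simp: F_def disjoint_open_family_def)
      ultimately show ?thesis
        using \<open>A \<noteq> B\<close> by (auto dest: pairwiseD)
    qed
    then have "pairwise disjnt (\<Union>C)"
      by (simp add: pairwise_def)
    with CF show ?thesis
      by (fastforce simp: F_def disjoint_open_family_def)
  qed
  then obtain \<A> where \<A>F: "\<A> \<in> F" and max: "\<And>\<B>. \<B> \<in> F \<Longrightarrow> \<A> \<subseteq> \<B> \<Longrightarrow> \<B> = \<A>"
    using subset_Zorn'[of F] by blast
  have dis: "disjoint_open_family X \<A>" and ref: "\<And>A. A \<in> \<A> \<Longrightarrow> \<exists>U\<in>\<U>. A \<subseteq> U"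
    using \<A>F by (auto simp: F_def)
  \<comment> \<open>Maximality within \<open>F\<close> as a membership test: inserting such a
    \<open>V\<close> keeps the family in \<open>F\<close>.\<close>
  have mem_if_refining: "V \<in> \<A>"
    if "openin X V" "U \<in> \<U>" "V \<subseteq> U" "\<And>A. A \<in> \<A> \<Longrightarrow> A \<noteq> V \<Longrightarrow> disjnt V A" for U V
  proof -
    have "insert V \<A> \<in> F"
      using that dis ref by (auto simp: F_def disjoint_open_family_def pairwise_insert disjnt_sym)
    then show ?thesis
      using max by blast
  qed
  have "B \<in> \<A>" if \<B>: "disjoint_open_family X \<B>" "\<A> \<subseteq> \<B>" and B: "B \<in> \<B>" for \<B> B
  proof (rule ccontr)
    assume notin: "B \<notin> \<A>"
    have disB: "disjnt B A" if "A \<in> \<A>" for A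
      using that \<B> B notin by (auto simp: disjoint_open_family_def dest: pairwiseD)
    have opB: "openin X B"
      using \<B> B by (simp add: disjoint_open_family_def)
    \<comment> \<open>The empty set passes the test, so it already belongs to
      \<open>\<A>\<close>.\<close>
    have "B \<noteq> {}"
      using mem_if_refining[of "{}"] ne notin by auto
    then obtain x U where x: "x \<in> B" "x \<in> U" "U \<in> \<U>"
      using openin_subset[OF opB] cover unfolding open_cover_def by blast
    \<comment> \<open>\<open>B\<close> itself may fit in no member of the cover, but its trace on
      \<open>U\<close> does. As a member of \<open>\<A>\<close> this trace is disjoint from
      \<open>B\<close>, yet both contain \<open>x\<close>.\<close>
    have "B \<inter> U \<in> \<A>"
    proof (rule mem_if_refining)
      show "openin X (B \<inter> U)"
        using opB x cover by (auto simp: open_cover_def)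
      show "disjnt (B \<inter> U) A" if "A \<in> \<A>" for A
        using disB[OF that] by (auto simp: disjnt_def)
    qed (use x in auto)
    with disB x show False
      by (auto simp: disjnt_def)
  qed
  then have "maximal_disjoint_open_family X \<A>"
    using dis by (auto simp: maximal_disjoint_open_family_def)
  with ref show thesis
    by (rule that[rotated -1])
qed

lemma selectively_k_star_ccc_imp_k_star_Lindelof:
  assumes ccc: "selectively_k_star_ccc k X"
  shows "k_star_Lindelof k X"
  unfolding k_star_Lindelof_def
proof (intro allI impI)
  fix \<U> assume cover: "open_cover X \<U>"
  show "\<exists>\<V>\<subseteq>\<U>. countable \<V> \<and> st k (\<Union>\<V>) \<U> = topspace X"
  \<comment> \<open>An empty cover forces an empty space, where every star of the empty set is
    empty.\<close>
  proof (cases "\<U> = {}")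
    case True
    then show ?thesis
      using cover by (cases k) (auto simp: open_cover_def)
  next
    case False
    then obtain \<A> where max: "maximal_disjoint_open_family X \<A>"
      and ref: "\<And>A. A \<in> \<A> \<Longrightarrow> \<exists>U\<in>\<U>. A \<subseteq> U"
      using maximal_disjoint_open_refinement_exists[OF cover] by blast
    obtain A :: "nat \<Rightarrow> 'a set"
      where A: "\<And>n. A n \<in> \<A>" and stA: "st k (\<Union>n. A n) \<U> = topspace X"
      using ccc[unfolded selectively_k_star_ccc_def, rule_format, of \<U> "\<lambda>_. \<A>"] cover max by auto
    obtain U where U: "\<And>n. U n \<in> \<U>" "\<And>n. A n \<subseteq> U n"
      using ref[OF A] by metis
    have "st k (\<Union>n. U n) \<U> = topspace X"
    proof
      show "st k (\<Union>n. U n) \<U> \<subseteq> topspace X"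
        using U(1) cover by (intro st_subset_topspace) (auto simp: open_cover_def)
      have "(\<Union>n. A n) \<subseteq> (\<Union>n. U n)"
        using U(2) by blast
      then show "topspace X \<subseteq> st k (\<Union>n. U n) \<U>"
        using st_mono stA by metis
    qed
    \<comment> \<open>The selection is indexed by the naturals, so \<open>range U\<close> is
      countable even if \<open>\<A>\<close> is not.\<close>
    then show ?thesis
      using U(1) by (intro exI[of _ "range U"]) auto
  qed
qed

theorem theorem2p1:
  fixes X :: "'a topology"
  shows "(\<forall>k::nat. k \<ge> 1 \<longrightarrow> selectively_k_star_ccc k X \<longrightarrow> k_star_Lindelof k X) \<and>
    (selectively_star_ccc X \<longrightarrow> star_Lindelof X)"
  by (simp add: selectively_k_star_ccc_imp_k_star_Lindelof selectively_star_ccc_def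
      star_Lindelof_def)

end
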